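(* For every $n\geqslant 4$, the Cayley–Dickson algebra $\mathbb{A}_n$, with left $\mathbb{O}$-multiplication $(p,x)\mapsto px$ given by the product of $\mathbb{A}_n$ and with $$\langle s,w\rangle_n:=\pi_{\mathbb{O}}(s\overline{w}),\qquad s,w\in\mathbb{A}_n,$$ is a Hilbert left $\mathbb{O}$-module.
   Context: $\mathbb{O}$ is the real algebra of octonions with its standard real basis $e_0=1,e_1,\dots,e_7$ and $\operatorname{Re}x=\tfrac12(x+\overline{x})$; $\mathbb{A}_3=\mathbb{O}$. For $n\ge 4$ the Cayley–Dickson algebra $\mathbb{A}_n$ is defined inductively: its elements are written uniquely as $a+be_{2^{n-1}}$ with $a,b\in\mathbb{A}_{n-1}$, conjugation is $\overline{a+be_{2^{n-1}}}=\overline{a}-be_{2^{n-1}}$, and multiplication is $$(a+be_{2^{n-1}})(c+de_{2^{n-1}})=(ac-\overline{d}b)+(da+b\overline{c})e_{2^{n-1}}.$$ $\mathbb{A}_n$ has canonical real basis $e_0,\dots,e_{2^n-1}$ where $e_{2^{n-1}+j}:=e_je_{2^{n-1}}$ for $1\le j\le 2^{n-1}-1$, and $\mathbb{O}\subset\mathbb{A}_n$ is the span of $e_0,\dots,e_7$. $\pi_{\mathbb{O}}:\mathbb{A}_n\to\mathbb{O}$ is the projection onto $\mathbb{O}$ killing $e_8,\dots,e_{2^n-1}$. A left $\mathbb{O}$-module is a real vector space $M$ with an $\mathbb{R}$-linear map $L:\mathbb{O}\to\operatorname{End}_{\mathbb{R}}(M)$, written $px:=L_p(x)$, such that $1x=x$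 and $[p,q,x]=-[q,p,x]$ for all $p,q\in\mathbb{O}$, $x\in M$, where $[p,q,x]:=(pq)x-p(qx)$ (equivalently $p(px)=p^2x$ for all $p,x$). A Hilbert left $\mathbb{O}$-module is a left $\mathbb{O}$-module $H$ with an $\mathbb{R}$-bilinear map $\langle\cdot,\cdot\rangle:H\times H\to\mathbb{O}$ such that for all $u,v\in H$, $p\in\mathbb{O}$: (1) $\operatorname{Re}(\langle pu,v\rangle-p\langle u,v\rangle)=0$; (2) $\langle u,v\rangle=\overline{\langle v,u\rangle}$; (3) $\langle u,u\rangle\in[0,\infty)$, and $\langle u,u\rangle=0$ iff $u=0$; and $H$ is complete for the norm $\|u\|=\sqrt{\langle u,u\rangle}$. *)

theory Defs
  imports "HOL-Analysis.Analysis" "HOL-Library.Function_Algebras"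
begin

section \<open>Cayley--Dickson algebras\<close>

text \<open>
  The algebras for all \<open>n\<close> live inside one ambient type, the sequences \<open>nat \<Rightarrow> real\<close> of
  coordinates with respect to \<open>e\<^sub>0, e\<^sub>1, \<dots>\<close>. Addition is the pointwise one of
  \<^theory>\<open>HOL-Library.Function_Algebras\<close>; that theory also makes \<open>*\<close> and \<open>1\<close> pointwise
  on functions, which are not the algebra operations and are not used here.
\<close>

instantiation "fun" :: (type, real_vector) real_vector
begin

definition "scaleR_fun r f = (\<lambda>x. r *\<^sub>R f x)"

instance
  by standard (auto simp: scaleR_fun_def plus_fun_def algebra_simps)

end

type_synonym coords = "nat \<Rightarrow> real"

definition cd_carrier :: "nat \<Rightarrow> coords set" where
  "cd_carrier n = {x. \<forall>i\<ge>2^n. x i = 0}"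

definition cd_basis :: "nat \<Rightarrow> coords" where
  "cd_basis i = (\<lambda>j. if j = i then 1 else 0)"

text \<open>
  The element \<open>a + b e\<close> of level \<open>Suc n\<close>, with \<open>a\<close>, \<open>b\<close> of level \<open>n\<close> and \<open>e\<close> the basis
  vector of index \<open>2^n\<close>, is \<open>cd_join n a b\<close>; the components are recovered by \<open>cd_fst n\<close> and
  \<open>cd_snd n\<close>. That these coordinates are the ones with respect to the canonical basis
  is lemma \<open>cd_mult_basis\<close> below.
\<close>

definition cd_join :: "nat \<Rightarrow> coords \<Rightarrow> coords \<Rightarrow> coords" where
  "cd_join n a b = (\<lambda>i. if i < 2^n then a i else b (i - 2^n))"

definition cd_fst :: "nat \<Rightarrow> coords \<Rightarrow> coords" where
  "cd_fst n x = (\<lambda>i. if i < 2^n then x i else 0)"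

definition cd_snd :: "nat \<Rightarrow> coords \<Rightarrow> coords" where
  "cd_snd n x = (\<lambda>i. if i < 2^n then x (2^n + i) else 0)"

primrec cd_conj :: "nat \<Rightarrow> coords \<Rightarrow> coords" where
  "cd_conj 0 x = x"
| "cd_conj (Suc n) x = cd_join n (cd_conj n (cd_fst n x)) (- cd_snd n x)"

text \<open>
  The doubling starts from the reals at level 0, so level 3 is the algebra of octonions, with
  \<open>e\<^sub>1 e\<^sub>2 = e\<^sub>3\<close>, \<open>e\<^sub>1 e\<^sub>4 = e\<^sub>5\<close>, \<open>e\<^sub>2 e\<^sub>4 = e\<^sub>6\<close>, \<open>e\<^sub>3 e\<^sub>4 = e\<^sub>7\<close>.
\<close>

primrec cd_mult :: "nat \<Rightarrow> coords \<Rightarrow> coords \<Rightarrow> coords" where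
  "cd_mult 0 x y = (\<lambda>i. if i = 0 then x 0 * y 0 else 0)"
| "cd_mult (Suc n) x y =
     (let a = cd_fst n x; b = cd_snd n x; c = cd_fst n y; d = cd_snd n y in
      cd_join n (cd_mult n a c - cd_mult n (cd_conj n d) b)
                (cd_mult n d a + cd_mult n b (cd_conj n c)))"

section \<open>Octonions\<close>

abbreviation Oct :: "coords set" where "Oct \<equiv> cd_carrier 3"
abbreviation oct_one :: coords where "oct_one \<equiv> cd_basis 0"
abbreviation oct_mult :: "coords \<Rightarrow> coords \<Rightarrow> coords" where "oct_mult \<equiv> cd_mult 3"
abbreviation oct_conj :: "coords \<Rightarrow> coords" where "oct_conj \<equiv> cd_conj 3"

definition oct_Re :: "coords \<Rightarrow> coords" where
  "oct_Re x = (1/2) *\<^sub>R (x + oct_conj x)"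

definition oct_proj :: "coords \<Rightarrow> coords" where
  "oct_proj x = (\<lambda>i. if i < 8 then x i else 0)"

section \<open>Hilbert left modules over the octonions\<close>

text \<open>
  The underlying real vector space is a linear subspace \<open>M\<close> of a real vector space type,
  and the operations are only constrained on \<open>M\<close>.
\<close>

locale left_Oct_module =
  fixes M :: "'a::real_vector set"
    and act :: "coords \<Rightarrow> 'a \<Rightarrow> 'a"
  assumes subspace_M: "subspace M"
    and act_closed: "\<lbrakk>p \<in> Oct; x \<in> M\<rbrakk> \<Longrightarrow> act p x \<in> M"
    and act_add_right: "\<lbrakk>p \<in> Oct; x \<in> M; y \<in> M\<rbrakk> \<Longrightarrow> act p (x + y) = act p x + act p y"
    and act_scaleR_right: "\<lbrakk>p \<in> Oct; x \<in> M\<rbrakk> \<Longrightarrow> act p (r *\<^sub>R x) = r *\<^sub>R act p x"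
    and act_add_left: "\<lbrakk>p \<in> Oct; q \<in> Oct; x \<in> M\<rbrakk> \<Longrightarrow> act (p + q) x = act p x + act q x"
    and act_scaleR_left: "\<lbrakk>p \<in> Oct; x \<in> M\<rbrakk> \<Longrightarrow> act (r *\<^sub>R p) x = r *\<^sub>R act p x"
    and act_one: "x \<in> M \<Longrightarrow> act oct_one x = x"
    and act_alternative: "\<lbrakk>p \<in> Oct; q \<in> Oct; x \<in> M\<rbrakk> \<Longrightarrow>
      act (oct_mult p q) x - act p (act q x) = - (act (oct_mult q p) x - act q (act p x))"

text \<open>
  On the diagonal \<open>ip u u\<close> is required to be a real multiple of \<open>e\<^sub>0 = 1\<close> (axiom \<open>ip_self\<close>
  below), and \<open>ip u u 0\<close> is that real number.
\<close>

definition ip_norm :: "('a \<Rightarrow> 'a \<Rightarrow> coords) \<Rightarrow> 'a \<Rightarrow> real" where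
  "ip_norm ip u = sqrt (ip u u 0)"

locale Hilbert_left_Oct_module = left_Oct_module H act
  for H :: "'a::real_vector set" and act :: "coords \<Rightarrow> 'a \<Rightarrow> 'a" +
  fixes ip :: "'a \<Rightarrow> 'a \<Rightarrow> coords"
  assumes ip_closed: "\<lbrakk>u \<in> H; v \<in> H\<rbrakk> \<Longrightarrow> ip u v \<in> Oct"
    and ip_add_left: "\<lbrakk>u \<in> H; u' \<in> H; v \<in> H\<rbrakk> \<Longrightarrow> ip (u + u') v = ip u v + ip u' v"
    and ip_scaleR_left: "\<lbrakk>u \<in> H; v \<in> H\<rbrakk> \<Longrightarrow> ip (r *\<^sub>R u) v = r *\<^sub>R ip u v"
    and ip_add_right: "\<lbrakk>u \<in> H; v \<in> H; v' \<in> H\<rbrakk> \<Longrightarrow> ip u (v + v') = ip u v + ip u v'"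
    and ip_scaleR_right: "\<lbrakk>u \<in> H; v \<in> H\<rbrakk> \<Longrightarrow> ip u (r *\<^sub>R v) = r *\<^sub>R ip u v"
    and ip_act: "\<lbrakk>p \<in> Oct; u \<in> H; v \<in> H\<rbrakk> \<Longrightarrow>
      oct_Re (ip (act p u) v - oct_mult p (ip u v)) = 0"
    and ip_conj: "\<lbrakk>u \<in> H; v \<in> H\<rbrakk> \<Longrightarrow> ip u v = oct_conj (ip v u)"
    and ip_self: "u \<in> H \<Longrightarrow> \<exists>r\<ge>0. ip u u = r *\<^sub>R oct_one"
    and ip_self_eq_0_iff: "u \<in> H \<Longrightarrow> ip u u = 0 \<longleftrightarrow> u = 0"
    and complete_H: "\<lbrakk>\<And>i. X i \<in> H;
      \<And>e. e > 0 \<Longrightarrow> \<exists>N. \<forall>i\<ge>N. \<forall>j\<ge>N. ip_norm ip (X i - X j) < e\<rbrakk> \<Longrightarrow>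
      \<exists>l\<in>H. (\<lambda>i. ip_norm ip (X i - l)) \<longlonglongrightarrow> 0"

section \<open>The coordinates belong to the canonical basis\<close>

lemma cd_conj_zero: "cd_conj n 0 = 0"
  by (induction n) (auto simp: cd_join_def cd_fst_def cd_snd_def zero_fun_def fun_eq_iff)

lemma cd_mult_zero: "cd_mult n x 0 = 0 \<and> cd_mult n 0 x = 0"
proof (induction n arbitrary: x)
  case (Suc n)
  have "cd_fst n 0 = 0" "cd_snd n 0 = 0" "cd_join n 0 0 = 0"
    by (auto simp: cd_join_def cd_fst_def cd_snd_def zero_fun_def fun_eq_iff)
  then show ?case
    by (simp add: Suc cd_conj_zero Let_def flip: zero_fun_def)
qed (auto simp: zero_fun_def)

lemma cd_conj_one: "cd_conj n (cd_basis 0) = cd_basis 0"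
proof (induction n)
  case (Suc n)
  have "cd_fst n (cd_basis 0) = cd_basis 0" "cd_snd n (cd_basis 0) = 0"
    "cd_join n (cd_basis 0) 0 = cd_basis 0"
    by (auto simp: cd_join_def cd_fst_def cd_snd_def cd_basis_def zero_fun_def fun_eq_iff)
  then show ?case
    by (simp add: Suc)
qed simp

lemma cd_mult_one:
  "x \<in> cd_carrier n \<Longrightarrow> cd_mult n x (cd_basis 0) = x \<and> cd_mult n (cd_basis 0) x = x"
proof (induction n arbitrary: x)
  case 0
  then show ?case by (auto simp: cd_basis_def cd_carrier_def fun_eq_iff)
next
  case (Suc n)
  have *: "cd_fst n (cd_basis 0) = cd_basis 0" "cd_snd n (cd_basis 0) = 0"
    by (auto simp: cd_fst_def cd_snd_def cd_basis_def zero_fun_def fun_eq_iff)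
  have "cd_fst n x \<in> cd_carrier n" "cd_snd n x \<in> cd_carrier n"
    by (auto simp: cd_fst_def cd_snd_def cd_carrier_def)
  moreover have "cd_join n (cd_fst n x) (cd_snd n x) = x"
    using Suc.prems by (auto simp: cd_join_def cd_fst_def cd_snd_def cd_carrier_def fun_eq_iff)
  ultimately show ?case
    by (simp add: Let_def Suc.IH * cd_mult_zero cd_conj_one cd_conj_zero flip: zero_fun_def)
qed

lemma cd_mult_basis:
  assumes "j < 2^n"
  shows "cd_mult (Suc n) (cd_basis j) (cd_basis (2^n)) = cd_basis (2^n + j)"
proof -
  have "cd_fst n (cd_basis j) = cd_basis j" "cd_snd n (cd_basis j) = 0"
    "cd_fst n (cd_basis (2^n)) = 0" "cd_snd n (cd_basis (2^n)) = cd_basis 0"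
    using assms by (auto simp: cd_fst_def cd_snd_def cd_basis_def zero_fun_def fun_eq_iff)
  moreover have "cd_basis j \<in> cd_carrier n"
    using assms by (auto simp: cd_basis_def cd_carrier_def)
  moreover have "cd_join n 0 (cd_basis j) = cd_basis (2^n + j)"
    using assms by (auto simp: cd_join_def cd_basis_def zero_fun_def fun_eq_iff)
  ultimately show ?thesis
    by (simp add: Let_def cd_mult_zero cd_mult_one cd_conj_zero flip: zero_fun_def)
qed

end

theory Submission
  imports Defs
begin

text \<open>
  Write \<open>N x\<close> for the sum of the squared coordinates, so that \<open>x x\<^sup>* = x\<^sup>* x = N x\<close> in every
  Cayley--Dickson algebra. If level \<open>k\<close> is associative, then \<open>p\<^sup>* (p x) = N p x\<close> at level \<open>k + 1\<close>;
  for octonions \<open>p\<close> this identity and its mirror image, obtained by conjugation, then survive each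
  further doubling, since \<open>p (c + d e) = p c + (d p) e\<close>. As \<open>p\<^sup>* = 2 Re p - p\<close>, this is
  the alternative law for the action of the octonions, and polarization gives the module axiom.
  The axioms of the inner product come from \<open>Re ((x y) z) = Re (x (y z))\<close>, valid at every level,
  and completeness is that of a finite-dimensional Euclidean space.
\<close>

section \<open>Linearity and coordinates\<close>

lemma cd_fst_linear:
  "cd_fst n (x + y) = cd_fst n x + cd_fst n y"
  "cd_fst n (x - y) = cd_fst n x - cd_fst n y"
  "cd_fst n (- x) = - cd_fst n x"
  "cd_fst n (r *\<^sub>R x) = r *\<^sub>R cd_fst n x"
  "cd_fst n 0 = 0"
  by (auto simp: cd_fst_def fun_eq_iff scaleR_fun_def zero_fun_def)

lemma cd_snd_linear:
  "cd_snd n (x + y) = cd_snd n x + cd_snd n y"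
  "cd_snd n (x - y) = cd_snd n x - cd_snd n y"
  "cd_snd n (- x) = - cd_snd n x"
  "cd_snd n (r *\<^sub>R x) = r *\<^sub>R cd_snd n x"
  "cd_snd n 0 = 0"
  by (auto simp: cd_snd_def fun_eq_iff scaleR_fun_def zero_fun_def)

lemma cd_join_linear:
  "cd_join n a b + cd_join n c d = cd_join n (a + c) (b + d)"
  "cd_join n a b - cd_join n c d = cd_join n (a - c) (b - d)"
  "- cd_join n a b = cd_join n (- a) (- b)"
  "r *\<^sub>R cd_join n a b = cd_join n (r *\<^sub>R a) (r *\<^sub>R b)"
  "cd_join n 0 0 = 0"
  by (auto simp: cd_join_def fun_eq_iff scaleR_fun_def zero_fun_def)

lemma cd_conj_linear:
  "cd_conj n (x + y) = cd_conj n x + cd_conj n y"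
  "cd_conj n (x - y) = cd_conj n x - cd_conj n y"
  "cd_conj n (- x) = - cd_conj n x"
  "cd_conj n (r *\<^sub>R x) = r *\<^sub>R cd_conj n x"
  by (induction n arbitrary: x y)
     (simp_all add: cd_fst_linear cd_snd_linear cd_join_linear)

lemma cd_mult_add:
  "cd_mult n (x + y) z = cd_mult n x z + cd_mult n y z \<and>
   cd_mult n z (x + y) = cd_mult n z x + cd_mult n z y"
proof (induction n arbitrary: x y z)
  case 0
  then show ?case by (auto simp: fun_eq_iff algebra_simps)
next
  case (Suc n)
  show ?case
    by (simp add: Suc cd_fst_linear cd_snd_linear cd_join_linear cd_conj_linear Let_def
        algebra_simps del: plus_fun_apply)
qed

lemma cd_mult_scaleR:
  "cd_mult n (r *\<^sub>R x) z = r *\<^sub>R cd_mult n x z \<and> cd_mult n z (r *\<^sub>R x) = r *\<^sub>R cd_mult n z x"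
proof (induction n arbitrary: x z)
  case 0
  then show ?case by (auto simp: fun_eq_iff scaleR_fun_def)
next
  case (Suc n)
  show ?case
    by (simp add: Suc cd_fst_linear cd_snd_linear cd_join_linear cd_conj_linear Let_def algebra_simps)
qed

lemma cd_mult_minus:
  "cd_mult n (- x) z = - cd_mult n x z" "cd_mult n z (- x) = - cd_mult n z x"
  using cd_mult_scaleR[of n "-1" x z] by simp_all

lemma cd_mult_diff:
  "cd_mult n (x - y) z = cd_mult n x z - cd_mult n y z"
  "cd_mult n z (x - y) = cd_mult n z x - cd_mult n z y"
  using cd_mult_add[of n x "- y" z] by (simp_all add: cd_mult_minus)

lemmas cd_mult_linear =
  cd_mult_add[THEN conjunct1] cd_mult_add[THEN conjunct2]
  cd_mult_scaleR[THEN conjunct1] cd_mult_scaleR[THEN conjunct2]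
  cd_mult_minus cd_mult_diff
  cd_mult_zero[THEN conjunct1] cd_mult_zero[THEN conjunct2]

lemma cd_carrier_simps [simp]:
  "0 \<in> cd_carrier n"
  "cd_basis 0 \<in> cd_carrier n"
  "cd_fst n z \<in> cd_carrier n"
  "cd_snd n z \<in> cd_carrier n"
  "x \<in> cd_carrier n \<Longrightarrow> - x \<in> cd_carrier n"
  "x \<in> cd_carrier n \<Longrightarrow> r *\<^sub>R x \<in> cd_carrier n"
  "\<lbrakk>x \<in> cd_carrier n; y \<in> cd_carrier n\<rbrakk> \<Longrightarrow> x + y \<in> cd_carrier n"
  "\<lbrakk>x \<in> cd_carrier n; y \<in> cd_carrier n\<rbrakk> \<Longrightarrow> x - y \<in> cd_carrier n"
  by (auto simp: cd_carrier_def cd_fst_def cd_snd_def cd_basis_def scaleR_fun_def)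

lemma cd_carrier_mono: "\<lbrakk>m \<le> n; x \<in> cd_carrier m\<rbrakk> \<Longrightarrow> x \<in> cd_carrier n"
  using order_trans[OF power_increasing[of m n "2::nat"]] by (auto simp: cd_carrier_def)

lemma cd_join_carrier [simp]: "b \<in> cd_carrier n \<Longrightarrow> cd_join n a b \<in> cd_carrier (Suc n)"
  by (auto simp: cd_carrier_def cd_join_def)

lemma cd_fst_carrier_id [simp]: "x \<in> cd_carrier n \<Longrightarrow> cd_fst n x = x"
  by (auto simp: cd_carrier_def cd_fst_def fun_eq_iff)

lemma cd_snd_carrier_zero [simp]: "x \<in> cd_carrier n \<Longrightarrow> cd_snd n x = 0"
  by (auto simp: cd_carrier_def cd_snd_def fun_eq_iff zero_fun_def)

text \<open>\<open>cd_join\<close> does not truncate its components, so a \<open>cd_fst n\<close>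
  stays on the right; it disappears for components in level \<open>n\<close>.\<close>

lemma cd_fst_join [simp]: "cd_fst n (cd_join n a b) = cd_fst n a"
  by (auto simp: cd_fst_def cd_join_def fun_eq_iff)

lemma cd_snd_join [simp]: "cd_snd n (cd_join n a b) = cd_fst n b"
  by (auto simp: cd_fst_def cd_snd_def cd_join_def fun_eq_iff)

lemma cd_join_fst_snd [simp]: "x \<in> cd_carrier (Suc n) \<Longrightarrow> cd_join n (cd_fst n x) (cd_snd n x) = x"
  by (auto simp: cd_join_def cd_fst_def cd_snd_def cd_carrier_def fun_eq_iff)

lemma cd_join_zero: "x \<in> cd_carrier n \<Longrightarrow> cd_join n x 0 = x"
  by (auto simp: cd_join_def cd_carrier_def fun_eq_iff zero_fun_def)

lemma cd_join_at_0 [simp]: "cd_join n a b 0 = a 0"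
  by (simp add: cd_join_def)

lemma cd_fst_at_0 [simp]: "cd_fst n x 0 = x 0"
  by (simp add: cd_fst_def)

lemma cd_conj_carrier [simp]: "x \<in> cd_carrier n \<Longrightarrow> cd_conj n x \<in> cd_carrier n"
  by (cases n) auto

lemma cd_mult_carrier [simp]: "cd_mult n x y \<in> cd_carrier n"
  by (induction n arbitrary: x y) (auto simp: Let_def, simp add: cd_carrier_def)

section \<open>Conjugation, trace and norm\<close>

lemma cd_conj_conj [simp]: "x \<in> cd_carrier n \<Longrightarrow> cd_conj n (cd_conj n x) = x"
  by (induction n arbitrary: x) (auto simp: cd_snd_linear)

lemma cd_conj_mult: "cd_conj n (cd_mult n x y) = cd_mult n (cd_conj n y) (cd_conj n x)"
proof (induction n arbitrary: x y)
  case (Suc n)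
  then show ?case
    by (simp add: Let_def cd_mult_linear cd_conj_linear cd_fst_linear algebra_simps)
qed (simp add: mult.commute fun_eq_iff)

lemma cd_conj_at_0 [simp]: "cd_conj n x 0 = x 0"
  by (induction n arbitrary: x) simp_all

text \<open>The formula on the right does not mention \<open>n\<close>; this is why conjugation is
  compatible with inclusion of levels and with projection.\<close>

lemma cd_conj_eq: "x \<in> cd_carrier n \<Longrightarrow> cd_conj n x = (2 * x 0) *\<^sub>R cd_basis 0 - x"
proof (induction n arbitrary: x)
  case 0
  then show ?case
    by (auto simp: cd_carrier_def cd_basis_def fun_eq_iff scaleR_fun_def)
next
  case (Suc n)
  have "(2 * x 0) *\<^sub>R cd_basis 0 - x =
      (2 * x 0) *\<^sub>R cd_join n (cd_basis 0) 0 - cd_join n (cd_fst n x) (cd_snd n x)"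
    using Suc.prems by (simp add: cd_join_zero)
  also have "\<dots> = cd_conj (Suc n) x"
    by (simp add: cd_join_linear Suc.IH del: minus_apply)
  finally show ?case ..
qed

text \<open>Coordinate 0 is the real part. Conjugation fixes it and reverses products, so
  \<open>d\<^sup>* b\<close> and \<open>b\<^sup>* d\<close> have the same real part;
  \<open>a c\<close> and \<open>c a\<close> agree by induction.\<close>

lemma cd_mult_at_0_commute: "cd_mult n x y 0 = cd_mult n y x 0"
proof (induction n arbitrary: x y)
  case (Suc n)
  have "cd_mult n (cd_conj n (cd_snd n y)) (cd_snd n x) 0 =
      cd_conj n (cd_mult n (cd_conj n (cd_snd n y)) (cd_snd n x)) 0"
    by simp
  also have "\<dots> = cd_mult n (cd_conj n (cd_snd n x)) (cd_snd n y) 0"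
    unfolding cd_conj_mult by simp
  finally show ?case
    using Suc by (simp add: Let_def)
qed (simp add: mult.commute)

lemma cd_mult_at_0_assoc: "cd_mult n (cd_mult n x y) z 0 = cd_mult n x (cd_mult n y z) 0"
proof (induction n arbitrary: x y z)
  case (Suc n)
  define a b c d f g where defs: "a = cd_fst n x" "b = cd_snd n x" "c = cd_fst n y"
    "d = cd_snd n y" "f = cd_fst n z" "g = cd_snd n z"
  let ?m = "cd_mult n" and ?c = "cd_conj n"
  \<comment> \<open>Both sides expand into four triple products. They match in pairs, since real
    parts at level \<open>n\<close> are invariant under cyclic shifts.\<close>
  have "?m (?m (?c d) b) f 0 = ?m (?m f (?c d)) b 0"
    by (metis Suc cd_mult_at_0_commute)
  moreover have "?m (?c g) (?m d a) 0 = ?m a (?m (?c g) d) 0"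
    by (metis Suc cd_mult_at_0_commute)
  moreover have "?m (?c g) (?m b (?c c)) 0 = ?m (?m (?c c) (?c g)) b 0"
    by (metis Suc cd_mult_at_0_commute)
  moreover have "?m (?m a c) f 0 = ?m a (?m c f) 0"
    by (rule Suc)
  ultimately show ?case
    by (simp add: Let_def cd_mult_linear cd_conj_linear cd_conj_mult flip: defs)
       (simp add: defs)
qed simp

definition cd_nsq :: "nat \<Rightarrow> coords \<Rightarrow> real" where
  "cd_nsq n x = (\<Sum>i<2^n. (x i)\<^sup>2)"

lemma cd_nsq_Suc: "cd_nsq (Suc n) x = cd_nsq n (cd_fst n x) + cd_nsq n (cd_snd n x)"
proof -
  have "cd_nsq (Suc n) x = (\<Sum>i<2^n. (x i)\<^sup>2) + (\<Sum>i=2^n..<2^n + 2^n. (x i)\<^sup>2)"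
    unfolding cd_nsq_def lessThan_atLeast0 by (subst sum.atLeastLessThan_concat) (simp_all add: mult_2)
  also have "(\<Sum>i=2^n..<2^n + 2^n. (x i)\<^sup>2) = (\<Sum>i<2^n. (x (2^n + i))\<^sup>2)"
    using sum.shift_bounds_nat_ivl[of "\<lambda>i. (x i)\<^sup>2" 0 "2^n" "2^n"]
    by (simp add: lessThan_atLeast0 add.commute)
  finally show ?thesis
    by (simp add: cd_nsq_def cd_fst_def cd_snd_def)
qed

lemma cd_nsq_0 [simp]: "cd_nsq n 0 = 0"
  by (simp add: cd_nsq_def)

lemma cd_nsq_minus: "cd_nsq n (- x) = cd_nsq n x"
  by (simp add: cd_nsq_def)

lemma cd_nsq_conj: "x \<in> cd_carrier n \<Longrightarrow> cd_nsq n (cd_conj n x) = cd_nsq n x"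
  by (induction n arbitrary: x) (simp_all add: cd_nsq_Suc cd_nsq_minus cd_fst_linear)

lemma cd_nsq_eq_0_iff: "x \<in> cd_carrier n \<Longrightarrow> cd_nsq n x = 0 \<longleftrightarrow> x = 0"
  by (auto simp: cd_nsq_def sum_nonneg_eq_0_iff cd_carrier_def fun_eq_iff) (metis lessThan_iff not_le)

text \<open>For \<open>x = a + b e\<close> the first component of \<open>x x\<^sup>*\<close> is
  \<open>a a\<^sup>* + b\<^sup>* b\<close>, which mixes the two orders, so both identities go
  through one induction.\<close>

lemma cd_mult_conj:
  "cd_mult n x (cd_conj n x) = cd_nsq n x *\<^sub>R cd_basis 0 \<and>
   cd_mult n (cd_conj n x) x = cd_nsq n x *\<^sub>R cd_basis 0"
proof (induction n arbitrary: x)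
  case 0
  then show ?case
    by (auto simp: cd_nsq_def cd_basis_def fun_eq_iff scaleR_fun_def power2_eq_square)
next
  case (Suc n)
  have "cd_join n (r *\<^sub>R cd_basis 0) 0 = r *\<^sub>R cd_basis 0" for r
    by (simp add: cd_join_zero)
  with Suc show ?case
    by (simp add: Let_def cd_mult_linear cd_conj_linear cd_fst_linear cd_nsq_Suc
        flip: scaleR_add_left)
qed

section \<open>Compatibility of the levels\<close>

lemma cd_conj_eq_level: "\<lbrakk>m \<le> n; x \<in> cd_carrier m\<rbrakk> \<Longrightarrow> cd_conj n x = cd_conj m x"
  using cd_conj_eq cd_carrier_mono by simp

text \<open>Elements of level \<open>n\<close> have second component 0 at level
  \<open>Suc n\<close>, so only the term \<open>a c\<close> of the doubling formula survives. On
  \<open>Oct\<close> this identifies \<open>oct_mult\<close> with the product of higher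
  levels.\<close>

lemma cd_mult_eq_level:
  "\<lbrakk>m \<le> n; x \<in> cd_carrier m; y \<in> cd_carrier m\<rbrakk> \<Longrightarrow> cd_mult n x y = cd_mult m x y"
proof (induction n rule: dec_induct)
  case (step n)
  then have "x \<in> cd_carrier n" "y \<in> cd_carrier n"
    by (auto intro: cd_carrier_mono)
  with step show ?case
    by (simp add: Let_def cd_mult_linear cd_conj_zero cd_join_zero cd_carrier_mono)
qed simp

lemma cd_fst_conj: "\<lbrakk>m \<le> n; x \<in> cd_carrier n\<rbrakk> \<Longrightarrow> cd_fst m (cd_conj n x) = cd_conj m (cd_fst m x)"
  by (simp add: cd_conj_eq cd_fst_linear)

lemma cd_fst_fst: "m \<le> n \<Longrightarrow> cd_fst m (cd_fst n x) = cd_fst m x"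
proof -
  assume "m \<le> n"
  then have "i < 2^n" if "i < 2^m" for i :: nat
    using that by (meson order_less_le_trans one_le_numeral power_increasing)
  then show ?thesis
    by (auto simp: cd_fst_def fun_eq_iff)
qed

text \<open>For \<open>p\<close> in level \<open>n\<close>, the real part of
  \<open>p (c + d e) = p c + (d p) e\<close> sees only \<open>c\<close>. At \<open>m = 3\<close>,
  the real part of \<open>p x\<close> depends only on the octonion projection of
  \<open>x\<close>.\<close>

lemma cd_mult_at_0_fst:
  "\<lbrakk>m \<le> n; p \<in> cd_carrier m\<rbrakk> \<Longrightarrow> cd_mult n p x 0 = cd_mult m p (cd_fst m x) 0"
proof (induction n arbitrary: x rule: dec_induct)
  case base
  \<comment> \<open>\<open>x\<close> may have coordinates of index \<ge> \<open>2^m\<close>; one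
    unfolding of the product shows that it ignores them.\<close>
  then show ?case
    by (cases m) (simp_all add: Let_def cd_snd_def cd_fst_def cong: if_cong)
next
  case (step n)
  then have "p \<in> cd_carrier n"
    by (auto intro: cd_carrier_mono)
  with step show ?case
    by (simp add: Let_def cd_mult_linear cd_fst_fst)
qed

section \<open>Alternativity of the octonion action\<close>

text \<open>Level 1 is the complex numbers; being commutative and associative, it makes level 2, the
  quaternions, associative.\<close>

lemma cd_mult_commute_1: "cd_mult 1 x y = cd_mult 1 y x"
  by (auto simp: Let_def cd_join_def fun_eq_iff)

lemma cd_mult_assoc_1: "cd_mult 1 (cd_mult 1 x y) z = cd_mult 1 x (cd_mult 1 y z)"
  by (auto simp: Let_def cd_join_def cd_fst_def cd_snd_def fun_eq_iff algebra_simps)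

lemma cd_mult_assoc_Suc:
  assumes comm: "\<And>x y. cd_mult n x y = cd_mult n y x"
    and assoc: "\<And>x y z. cd_mult n (cd_mult n x y) z = cd_mult n x (cd_mult n y z)"
  shows "cd_mult (Suc n) (cd_mult (Suc n) x y) z = cd_mult (Suc n) x (cd_mult (Suc n) y z)"
proof -
  \<comment> \<open>With \<open>assoc\<close> and \<open>comm\<close> this brings the expanded
    triple products to an AC normal form.\<close>
  have lcomm: "cd_mult n x (cd_mult n y z) = cd_mult n y (cd_mult n x z)" for x y z
    by (metis comm assoc)
  show ?thesis
    by (simp add: Let_def cd_mult_linear cd_conj_linear cd_conj_mult cd_fst_linear)
       (simp add: assoc comm lcomm algebra_simps)
qed

text \<open>For \<open>p = a + b e\<close> and \<open>x = c + d e\<close>, associativity lets the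
  cross terms \<open>a\<^sup>* d\<^sup>* b\<close> and \<open>b c\<^sup>* a\<^sup>*\<close> cancel.
  The components left are \<open>a\<^sup>* a c + c b\<^sup>* b\<close> and
  \<open>d a a\<^sup>* + b b\<^sup>* d\<close>, where the norms are real and factor out.\<close>

lemma cd_mult_conj_cancel_Suc:
  assumes assoc: "\<And>x y z. cd_mult n (cd_mult n x y) z = cd_mult n x (cd_mult n y z)"
    and x: "x \<in> cd_carrier (Suc n)"
  shows "cd_mult (Suc n) (cd_conj (Suc n) p) (cd_mult (Suc n) p x) = cd_nsq (Suc n) p *\<^sub>R x"
proof -
  define a b c d where defs: "a = cd_fst n p" "b = cd_snd n p" "c = cd_fst n x" "d = cd_snd n x"
  have [simp]: "a \<in> cd_carrier n" "b \<in> cd_carrier n" "c \<in> cd_carrier n" "d \<in> cd_carrier n"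
    by (simp_all add: defs)
  have cancel: "cd_mult n (cd_conj n u) (cd_mult n u w) = cd_nsq n u *\<^sub>R w"
    "cd_mult n u (cd_mult n (cd_conj n u) w) = cd_nsq n u *\<^sub>R w" if "w \<in> cd_carrier n" for u w
    by (simp_all add: cd_mult_conj cd_mult_linear cd_mult_one that flip: assoc)
  have "cd_mult (Suc n) (cd_conj (Suc n) p) (cd_mult (Suc n) p x) =
      cd_join n (cd_nsq (Suc n) p *\<^sub>R c) (cd_nsq (Suc n) p *\<^sub>R d)"
    by (simp add: Let_def cd_mult_linear cd_conj_linear cd_conj_mult cd_fst_linear cd_nsq_Suc
        flip: defs)
       (simp add: assoc cancel cd_mult_conj cd_mult_linear cd_mult_one algebra_simps)
  also have "\<dots> = cd_nsq (Suc n) p *\<^sub>R x"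
    using x by (simp add: defs flip: cd_join_linear)
  finally show ?thesis .
qed

lemma cd_mult_conj_cancel_right:
  assumes left: "\<And>p x. \<lbrakk>p \<in> cd_carrier m; x \<in> cd_carrier n\<rbrakk> \<Longrightarrow>
      cd_mult n (cd_conj n p) (cd_mult n p x) = cd_nsq n p *\<^sub>R x"
    and "m \<le> n" "p \<in> cd_carrier m" "x \<in> cd_carrier n"
  shows "cd_mult n (cd_mult n x p) (cd_conj n p) = cd_nsq n p *\<^sub>R x"
proof -
  have p: "p \<in> cd_carrier n" "cd_conj n p \<in> cd_carrier m"
    using assms(2,3) by (simp_all add: cd_carrier_mono cd_conj_eq_level)
  have "cd_mult n (cd_mult n x p) (cd_conj n p) =
      cd_conj n (cd_mult n (cd_conj n (cd_conj n p)) (cd_mult n (cd_conj n p) (cd_conj n x)))"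
    using p assms(4) by (simp add: cd_conj_mult)
  \<comment> \<open>Keeping the double conjugate of \<open>p\<close> lets \<open>left\<close> apply
    with \<open>cd_conj n p\<close> in place of \<open>p\<close>; that of \<open>x\<close> is undone
    afterwards.\<close>
  also have "\<dots> = cd_nsq n p *\<^sub>R x"
    using p assms(4) by (simp add: left cd_nsq_conj cd_conj_linear del: cd_conj_conj)
       (simp add: cd_conj_conj)
  finally show ?thesis .
qed

lemma cd_mult_conj_cancel:
  assumes "n \<ge> 3" "p \<in> Oct" "x \<in> cd_carrier n"
  shows "cd_mult n (cd_conj n p) (cd_mult n p x) = cd_nsq n p *\<^sub>R x"
  using assms
proof (induction n arbitrary: p x rule: dec_induct)
  case base
  \<comment> \<open>The octonions double level 2, so associativity of the quaternions is what the
    base case requires.\<close>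
  have "cd_mult 2 (cd_mult 2 x y) z = cd_mult 2 x (cd_mult 2 y z)" for x y z
    using cd_mult_assoc_Suc[of 1, OF cd_mult_commute_1 cd_mult_assoc_1]
    by (simp only: Suc_1)
  from cd_mult_conj_cancel_Suc[of 2, OF this] base show ?case
    by (simp only: eval_nat_numeral)
next
  case (step n)
  have p: "p \<in> cd_carrier n" "p \<in> Oct"
    using step by (auto intro: cd_carrier_mono)
  \<comment> \<open>With \<open>d\<close> the second component of \<open>x\<close>, that of the
    doubled product is \<open>(d p) p\<^sup>*\<close>, where \<open>p\<close> acts from the
    right.\<close>
  have "cd_mult n (cd_mult n (cd_snd n x) p) (cd_conj n p) = cd_nsq n p *\<^sub>R cd_snd n x"
    using step p by (intro cd_mult_conj_cancel_right[of 3]) auto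
  with step p show ?case
    by (simp add: Let_def cd_mult_linear cd_conj_zero cd_nsq_Suc flip: cd_join_linear)
qed

lemma cd_mult_left_alternative:
  assumes "n \<ge> 3" "p \<in> Oct" "x \<in> cd_carrier n"
  shows "cd_mult n (cd_mult n p p) x = cd_mult n p (cd_mult n p x)"
proof -
  have p: "p \<in> cd_carrier n"
    using assms by (auto intro: cd_carrier_mono)
  have "cd_mult n p (cd_mult n p x) = (2 * p 0) *\<^sub>R cd_mult n p x - cd_nsq n p *\<^sub>R x"
    if "x \<in> cd_carrier n" for x
    using cd_mult_conj_cancel[OF assms(1,2) that]
    by (simp add: cd_conj_eq[OF p] cd_mult_linear cd_mult_one algebra_simps)
  from this[OF assms(3)] this[of "cd_basis 0"] show ?thesis
    using p assms(3) by (simp add: cd_mult_linear cd_mult_one)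
qed

lemma cd_mult_alternative:
  assumes "n \<ge> 3" "p \<in> Oct" "q \<in> Oct" "x \<in> cd_carrier n"
  shows "cd_mult n (oct_mult p q) x - cd_mult n p (cd_mult n q x) =
      - (cd_mult n (oct_mult q p) x - cd_mult n q (cd_mult n p x))"
  using cd_mult_left_alternative[OF assms(1) _ assms(4), of "p + q"]
    cd_mult_left_alternative[OF assms(1,2,4)] cd_mult_left_alternative[OF assms(1,3,4)] assms(2,3)
  by (simp add: cd_mult_linear algebra_simps flip: cd_mult_eq_level[OF assms(1)])

section \<open>The inner product\<close>

lemma oct_proj_eq_fst: "oct_proj x = cd_fst 3 x"
  by (simp add: oct_proj_def cd_fst_def)

lemma oct_Re_eq: "x \<in> Oct \<Longrightarrow> oct_Re x = x 0 *\<^sub>R oct_one"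
  by (simp add: oct_Re_def cd_conj_eq)

text \<open>Each coordinate is bounded by the norm and hence is a real Cauchy sequence; the
  coordinatewise limits, padded with 0 from index \<open>2^n\<close> on, form the limit.\<close>

lemma cd_nsq_complete:
  assumes X: "\<And>i. X i \<in> cd_carrier n"
    and Cauchy: "\<And>e. e > 0 \<Longrightarrow> \<exists>N. \<forall>i\<ge>N. \<forall>j\<ge>N. sqrt (cd_nsq n (X i - X j)) < e"
  shows "\<exists>l\<in>cd_carrier n. (\<lambda>i. sqrt (cd_nsq n (X i - l))) \<longlonglongrightarrow> 0"
proof -
  have coord: "\<bar>x k\<bar> \<le> sqrt (cd_nsq n x)" if "k < 2^n" for x k
    using that by (intro real_le_rsqrt) (auto simp: cd_nsq_def intro!: member_le_sum)
  have "convergent (\<lambda>i. X i k)" if "k < 2^n" for k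
  proof (rule real_Cauchy_convergent, rule metric_CauchyI)
    fix e :: real assume "e > 0"
    from Cauchy[OF this] obtain N where N: "\<forall>i\<ge>N. \<forall>j\<ge>N. sqrt (cd_nsq n (X i - X j)) < e" ..
    have "dist (X i k) (X j k) < e" if "i \<ge> N" "j \<ge> N" for i j
      using coord[OF \<open>k < 2^n\<close>, of "X i - X j"] N that
      by (auto simp: dist_real_def intro: le_less_trans)
    then show "\<exists>N. \<forall>i\<ge>N. \<forall>j\<ge>N. dist (X i k) (X j k) < e"
      by blast
  qed
  then have conv: "(\<lambda>i. X i k) \<longlonglongrightarrow> lim (\<lambda>i. X i k)" if "k < 2^n" for k
    using that convergent_LIMSEQ_iff by blast
  define l where "l = (\<lambda>k. if k < 2^n then lim (\<lambda>i. X i k) else 0)"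
  \<comment> \<open>The limit is written with \<open>l k - l k\<close> so that
    \<open>tendsto_intros\<close> matches it term by term.\<close>
  have "(\<lambda>i. sqrt (\<Sum>k<2^n. (X i k - l k)\<^sup>2)) \<longlonglongrightarrow> sqrt (\<Sum>k<(2::nat)^n. (l k - l k)\<^sup>2)"
    by (intro tendsto_intros) (simp add: l_def conv)
  then have "(\<lambda>i. sqrt (cd_nsq n (X i - l))) \<longlonglongrightarrow> 0"
    by (simp add: cd_nsq_def)
  moreover have "l \<in> cd_carrier n"
    by (simp add: l_def cd_carrier_def)
  ultimately show ?thesis by blast
qed

lemma cd_ip_self: "oct_proj (cd_mult n u (cd_conj n u)) = cd_nsq n u *\<^sub>R oct_one"
  by (simp add: cd_mult_conj oct_proj_eq_fst)

lemma cd_ip_norm: "ip_norm (\<lambda>s w. oct_proj (cd_mult n s (cd_conj n w))) u = sqrt (cd_nsq n u)"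
  by (simp add: ip_norm_def cd_ip_self scaleR_fun_def cd_basis_def)

text \<open>\<open>Re ((p u) v) = Re (p (u v))\<close>, and by \<open>cd_mult_at_0_fst\<close>
  projecting \<open>u v\<close> to \<open>Oct\<close> before multiplying by \<open>p\<close> keeps
  the real part. In the theorem \<open>v\<close> is a conjugate.\<close>

lemma cd_ip_act:
  assumes "n \<ge> 3" "p \<in> Oct"
  shows "oct_Re (oct_proj (cd_mult n (cd_mult n p u) v) - oct_mult p (oct_proj (cd_mult n u v))) = 0"
  using assms cd_mult_at_0_fst[OF assms, of "cd_mult n u v"]
  by (simp add: oct_Re_eq oct_proj_eq_fst cd_mult_at_0_assoc)

theorem theorem5p5:
  fixes n :: nat
  assumes "n \<ge> 4"
  shows "Hilbert_left_Oct_module (cd_carrier n) (cd_mult n)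
           (\<lambda>s w. oct_proj (cd_mult n s (cd_conj n w)))"
proof
  have n: "n \<ge> 3" using assms by simp
  show "subspace (cd_carrier n)"
    by (simp add: subspace_def)
  show "oct_Re (oct_proj (cd_mult n (cd_mult n p u) (cd_conj n v)) -
      oct_mult p (oct_proj (cd_mult n u (cd_conj n v)))) = 0" if "p \<in> Oct" for p u v
    using n that by (rule cd_ip_act)
  \<comment> \<open>Conjugating \<open>v u\<^sup>*\<close> gives \<open>u v\<^sup>*\<close>, and by
    \<open>cd_fst_conj\<close> projection commutes with conjugation.\<close>
  show "oct_proj (cd_mult n u (cd_conj n v)) = oct_conj (oct_proj (cd_mult n v (cd_conj n u)))"
    if "u \<in> cd_carrier n" "v \<in> cd_carrier n" for u v
    using n that by (simp add: oct_proj_eq_fst cd_conj_mult flip: cd_fst_conj)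
  show "\<exists>r\<ge>0. oct_proj (cd_mult n u (cd_conj n u)) = r *\<^sub>R oct_one" for u
    unfolding cd_ip_self by (rule exI[of _ "cd_nsq n u"]) (simp add: cd_nsq_def sum_nonneg)
  show "oct_proj (cd_mult n u (cd_conj n u)) = 0 \<longleftrightarrow> u = 0" if "u \<in> cd_carrier n" for u
  proof -
    have "oct_one \<noteq> 0"
      by (auto simp: cd_basis_def fun_eq_iff)
    then show ?thesis
      by (simp add: cd_ip_self cd_nsq_eq_0_iff that)
  qed
  show "cd_mult n (oct_mult p q) x - cd_mult n p (cd_mult n q x) =
      - (cd_mult n (oct_mult q p) x - cd_mult n q (cd_mult n p x))"
    if "p \<in> Oct" "q \<in> Oct" "x \<in> cd_carrier n" for p q x
    using n that by (rule cd_mult_alternative)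
  show "\<exists>l\<in>cd_carrier n.
      (\<lambda>i. ip_norm (\<lambda>s w. oct_proj (cd_mult n s (cd_conj n w))) (X i - l)) \<longlonglongrightarrow> 0"
    if "\<And>i. X i \<in> cd_carrier n"
      "\<And>e. e > 0 \<Longrightarrow> \<exists>N. \<forall>i\<ge>N. \<forall>j\<ge>N.
        ip_norm (\<lambda>s w. oct_proj (cd_mult n s (cd_conj n w))) (X i - X j) < e" for X
    using that unfolding cd_ip_norm by (rule cd_nsq_complete)
qed (simp_all add: cd_mult_linear cd_mult_one oct_proj_eq_fst cd_fst_linear cd_conj_linear)

end
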